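(* Let $C$ be a symmetric convex body in a real Hilbert space $H$. For every $\delta>0$ there exists a complete orthonormal system $\mathbf{e}$ in $H$ such that $$Q_{k-1}(\mathbf{e},C)\subseteq(3+\delta)\,Q_k(\mathbf{e},C)$$ for every integer $k\geq 2$.
   Context: All Hilbert spaces are real, of arbitrary (finite or infinite) dimension. A convex body in a Hilbert space $H$ is a closed, convex and bounded subset of $H$ with nonempty interior; it is symmetric if $C=-C$. A complete orthonormal system $\mathbf{e}=\{e_\gamma\}_{\gamma\in\Gamma}$ in $H$ is a family of unit vectors with $\langle e_\alpha,e_\beta\rangle=0$ for $\alpha\neq\beta$ whose linear span is dense in $H$. For a positive integer $k$, $[\Gamma]_k$ is the family of all subsets $S\subseteq\Gamma$ of cardinality $k$. For $S\subseteq\Gamma$, $P_S:H\to H$ is the orthogonal projection onto $\overline{\operatorname{span}}\{e_\gamma:\gamma\in S\}$. For a convex body $C\subset H$ and a positive integer $k$, the $k$-convex hull of $C$ with respect to $\mathbf{e}$ is $$Q_k(\mathbf{e},C)=\bigcap_{S\in[\Gamma]_k}P_S^{-1}\bigl(P_S(C)\bigr),$$ where $P_S^{-1}$ denotes preimage and an intersection over an empty family is $H$. For a scalar $t$, $tA=\{ta:a\in A\}$. *)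

theory Defs
  imports "HOL-Analysis.Analysis" "HOL-Library.Ramsey"
begin

(* A real Hilbert space is a type of sort {real_inner, banach}; the dimension is arbitrary. *)

definition convex_body :: "'a::{real_inner, banach} set \<Rightarrow> bool" where
  "convex_body C \<longleftrightarrow> closed C \<and> convex C \<and> bounded C \<and> interior C \<noteq> {}"

definition symmetric_set :: "'a::real_inner set \<Rightarrow> bool" where
  "symmetric_set C \<longleftrightarrow> C = uminus ` C"

(* The family (e \<gamma>), \<gamma> \<in> \<Gamma>; values of e outside \<Gamma> play no role. *)
definition complete_orthonormal_system ::
    "'i set \<Rightarrow> ('i \<Rightarrow> 'a::{real_inner, banach}) \<Rightarrow> bool" where
  "complete_orthonormal_system \<Gamma> e \<longleftrightarrow>
     (\<forall>\<gamma>\<in>\<Gamma>. norm (e \<gamma>) = 1) \<and>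
     pairwise (\<lambda>\<alpha> \<beta>. orthogonal (e \<alpha>) (e \<beta>)) \<Gamma> \<and>
     closure (span (e ` \<Gamma>)) = UNIV"

(* Orthogonal projection onto a subspace M. The point is unique if it exists, and it exists
   for every closed M; for other M the value may be unspecified. *)
definition orth_proj :: "'a::{real_inner, banach} set \<Rightarrow> 'a \<Rightarrow> 'a" where
  "orth_proj M x = (THE y. y \<in> M \<and> (\<forall>z\<in>M. orthogonal (x - y) z))"

definition coord_proj :: "('i \<Rightarrow> 'a::{real_inner, banach}) \<Rightarrow> 'i set \<Rightarrow> 'a \<Rightarrow> 'a" where
  "coord_proj e S = orth_proj (closure (span (e ` S)))"

(* nsets \<Gamma> k is the family of all k-element subsets of \<Gamma>; if it is empty, the intersection
   is the whole space. *)
definition k_convex_hull ::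
    "'i set \<Rightarrow> ('i \<Rightarrow> 'a::{real_inner, banach}) \<Rightarrow> nat \<Rightarrow> 'a set \<Rightarrow> 'a set" where
  "k_convex_hull \<Gamma> e k C = (\<Inter>S \<in> nsets \<Gamma> k. coord_proj e S -` (coord_proj e S ` C))"

end

theory Submission
  imports Defs
begin

text \<open>
  Suppose that \<open>P\<^sub>S x\<close> is to be compared with \<open>P\<^sub>S C\<close>, that \<open>u \<in> S\<close>, and that some \<open>c \<in> C\<close> has the
  same coordinates as \<open>x\<close> in \<open>S - {u}\<close>. Then \<open>P\<^sub>S x\<close> and \<open>P\<^sub>S c\<close> differ by a multiple of \<open>u\<close>, and if
  \<open>h\<close> is the supremum of \<open>\<bar>c \<bullet> u\<bar>\<close> over \<open>C\<close>, then this multiple is at most \<open>2 * h\<close>, because the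
  \<open>u\<close>-coordinate of \<open>x\<close> is also that of a point of \<open>C\<close>. So if \<open>P\<^sub>S C\<close> contains
  \<open>(h / (1 + \<epsilon>)) u\<close>, then \<open>P\<^sub>S x\<close> lies in
  \<open>P\<^sub>S C + 2 * (1 + \<epsilon>) * P\<^sub>S C = (3 + 2 * \<epsilon>) * P\<^sub>S C\<close>.

  It therefore suffices to find a complete orthonormal system in which every nonempty finite \<open>S\<close> has
  such an element \<open>u\<close>. A greedy choice gives one. Let \<open>K\<close> be the closed span of the vectors chosen so
  far, take a point \<open>a \<in> C\<close> whose distance to \<open>K\<close> is within the factor \<open>1 + \<epsilon>\<close> of the largest
  possible one, and let the next vector \<open>u\<close> be the direction of the component of \<open>a\<close> orthogonal to
  \<open>K\<close>. Then \<open>h\<close> is at most \<open>1 + \<epsilon>\<close> times the length of that component, and \<open>a\<close> lies in the closed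
  span of \<open>K\<close> and \<open>u\<close>, hence is orthogonal to every vector chosen later. Consequently the earliest
  element of \<open>S\<close> is an element as required.

  In a space of arbitrary dimension the greedy choice is transfinite. Zorn's lemma replaces the
  recursion: what is needed of the system is a statement about its finite subsets
  (\<open>greedy_system\<close>), it passes to unions of chains (\<open>greedy_system_Union\<close>), and a system whose span
  is not dense can be enlarged by one greedy step (\<open>greedy_system_extend\<close>). The comparison of
  hulls is \<open>k_convex_hull_greedy_system\<close>.
\<close>

section \<open>Orthogonal projections\<close>

lemma subspace_closure:
  fixes M :: "'a::real_normed_vector set"
  assumes "subspace M"
  shows "subspace (closure M)"
proof (rule subspaceI)
  show "0 \<in> closure M"
    using assms closure_subset subspace_0 by blast
  show "x + y \<in> closure M" if "x \<in> closure M" "y \<in> closure M" for x y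
  proof -
    obtain f g where "\<forall>n. f n \<in> M" "f \<longlonglongrightarrow> x" "\<forall>n. g n \<in> M" "g \<longlonglongrightarrow> y"
      using \<open>x \<in> closure M\<close> \<open>y \<in> closure M\<close> unfolding closure_sequential by blast
    then have "\<forall>n. f n + g n \<in> M" "(\<lambda>n. f n + g n) \<longlonglongrightarrow> x + y"
      by (simp_all add: subspace_add[OF assms] tendsto_add)
    then show ?thesis
      unfolding closure_sequential by (intro exI conjI)
  qed
  show "c *\<^sub>R x \<in> closure M" if "x \<in> closure M" for c x
  proof -
    obtain f where "\<forall>n. f n \<in> M" "f \<longlonglongrightarrow> x"
      using \<open>x \<in> closure M\<close> unfolding closure_sequential by blast
    then have "\<forall>n. c *\<^sub>R f n \<in> M" "(\<lambda>n. c *\<^sub>R f n) \<longlonglongrightarrow> c *\<^sub>R x"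
      by (simp_all add: subspace_scale[OF assms] tendsto_scaleR)
    then show ?thesis
      unfolding closure_sequential by (intro exI conjI)
  qed
qed

lemma orthogonal_to_closure_span:
  fixes w :: "'a::real_inner"
  assumes "\<And>v. v \<in> A \<Longrightarrow> orthogonal w v" and "z \<in> closure (span A)"
  shows "orthogonal w z"
proof -
  have "closed {z. orthogonal w z}"
    unfolding orthogonal_def by (intro closed_Collect_eq continuous_intros)
  moreover have "span A \<subseteq> {z. orthogonal w z}"
    using assms(1) by (intro span_minimal) (auto simp: subspace_def orthogonal_def inner_simps)
  ultimately show ?thesis
    using closure_minimal assms(2) by blast
qed

text \<open>The projection theorem. The points of \<open>M\<close> whose distance to \<open>x\<close> is almost minimal form a
  decreasing sequence of closed sets, whose diameters tend to zero by the parallelogram law;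
  completeness provides a common point.\<close>

lemma projection_exists:
  fixes M :: "'a::{real_inner, banach} set"
  assumes M: "subspace M" "closed M"
  shows "\<exists>y\<in>M. \<forall>z\<in>M. orthogonal (x - y) z"
proof -
  define D where "D = (INF y\<in>M. (norm (x - y))\<^sup>2)"
  have bdd: "bdd_below ((\<lambda>y. (norm (x - y))\<^sup>2) ` M)"
    by (auto intro: bdd_belowI[of _ 0])
  have D_le: "D \<le> (norm (x - y))\<^sup>2" if "y \<in> M" for y
    unfolding D_def by (rule cINF_lower[OF bdd that])
  define A where "A n = {y \<in> M. (norm (x - y))\<^sup>2 \<le> D + 1 / real (Suc n)}" for n
  obtain y where y: "\<And>n. y \<in> A n"
  proof (rule decreasing_closed_nest[of A])
    show "closed (A n)" for n
      unfolding A_def Collect_conj_eq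
      by (intro closed_Int closed_Collect_le continuous_intros) (use M in auto)
    show "A n \<noteq> {}" for n
    proof -
      have "M \<noteq> {}" using subspace_0[OF M(1)] by blast
      then have "D < D + 1 / real (Suc n) \<longleftrightarrow> (\<exists>y\<in>M. (norm (x - y))\<^sup>2 < D + 1 / real (Suc n))"
        unfolding D_def by (rule cINF_less_iff[OF _ bdd])
      then have "\<exists>y\<in>M. (norm (x - y))\<^sup>2 < D + 1 / real (Suc n)"
        by simp
      then show ?thesis
        by (auto simp: A_def intro: less_imp_le)
    qed
    show "A n \<subseteq> A m" if "m \<le> n" for m n
    proof -
      have "1 / real (Suc n) \<le> 1 / real (Suc m)"
        using that by (intro divide_left_mono) auto
      then show ?thesis
        by (auto simp: A_def)
    qed
    show "\<exists>n. \<forall>y\<in>A n. \<forall>z\<in>A n. dist y z < r" if "r > 0" for r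
    proof -
      obtain n where n: "1 / real (Suc n) < r\<^sup>2 / 4"
        using reals_Archimedean[of "r\<^sup>2 / 4"] \<open>r > 0\<close> by (auto simp: inverse_eq_divide)
      have "dist y z < r" if "y \<in> A n" "z \<in> A n" for y z
      proof -
        have "D \<le> (norm (x - (1/2) *\<^sub>R (y + z)))\<^sup>2"
          using that M(1) by (intro D_le) (auto simp: A_def intro: subspace_scale subspace_add)
        moreover have "(dist y z)\<^sup>2 + 4 * (norm (x - (1/2) *\<^sub>R (y + z)))\<^sup>2
            = 2 * (norm (x - y))\<^sup>2 + 2 * (norm (x - z))\<^sup>2"
          by (simp add: dist_norm power2_norm_eq_inner inner_simps inner_commute algebra_simps)
        moreover have "(norm (x - y))\<^sup>2 \<le> D + 1 / real (Suc n)" "(norm (x - z))\<^sup>2 \<le> D + 1 / real (Suc n)"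
          using that by (auto simp: A_def)
        ultimately have "(dist y z)\<^sup>2 < r\<^sup>2"
          using n by linarith
        then show ?thesis
          using \<open>r > 0\<close> by (simp add: power2_less_imp_less)
      qed
      then show ?thesis by blast
    qed
  qed blast
  have yM: "y \<in> M" using y[of 0] by (simp add: A_def)
  have y_min: "(norm (x - y))\<^sup>2 \<le> (norm (x - w))\<^sup>2" if "w \<in> M" for w
  proof -
    have "(norm (x - y))\<^sup>2 \<le> D"
    proof (rule field_le_epsilon)
      fix r :: real assume "r > 0"
      then obtain n where "1 / real (Suc n) < r"
        using reals_Archimedean[of r] by (auto simp: inverse_eq_divide)
      then show "(norm (x - y))\<^sup>2 \<le> D + r"
        using y[of n] by (simp add: A_def)
    qed
    then show ?thesis using D_le[OF that] by (rule order_trans)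
  qed
  have "orthogonal (x - y) z" if z: "z \<in> M" for z
  proof -
    have "(x - y) \<bullet> (w - y) \<le> 0" if "w \<in> M" for w
      using any_closest_point_dot[of M y w x] M yM that y_min
      by (auto simp: subspace_imp_convex dist_norm power2_le_iff_abs_le)
    \<comment> \<open>Both \<open>y + z\<close> and \<open>y - z\<close> lie in \<open>M\<close>, so the inequality holds with both signs.\<close>
    from this[of "y + z"] this[of "y - z"] show ?thesis
      using M(1) yM z by (auto simp: orthogonal_def subspace_add subspace_diff)
  qed
  with yM show ?thesis by blast
qed

lemma inner_orthonormal_sum:
  fixes e :: "'i \<Rightarrow> 'a::real_inner"
  assumes "finite S" and "\<And>\<gamma>. \<gamma> \<in> S \<Longrightarrow> norm (e \<gamma>) = 1"
    and "pairwise (\<lambda>\<alpha> \<beta>. orthogonal (e \<alpha>) (e \<beta>)) S" and "\<beta> \<in> S"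
  shows "(\<Sum>\<gamma>\<in>S. c \<gamma> *\<^sub>R e \<gamma>) \<bullet> e \<beta> = c \<beta>"
proof -
  have "(\<Sum>\<gamma>\<in>S. c \<gamma> *\<^sub>R e \<gamma>) \<bullet> e \<beta> = (\<Sum>\<gamma>\<in>S. if \<gamma> = \<beta> then c \<beta> else 0)"
    unfolding inner_sum_left
    using assms(2-4) by (intro sum.cong) (auto simp: pairwise_def orthogonal_def norm_eq_1)
  then show ?thesis using assms(1,4) by simp
qed

text \<open>The Fourier sum lies in the span and the remainder is orthogonal to it; two points of the closed
  span with this property differ by a vector orthogonal to itself.\<close>

lemma coord_proj_finite:
  fixes e :: "'i \<Rightarrow> 'a::{real_inner, banach}"
  assumes "finite S" and "\<And>\<gamma>. \<gamma> \<in> S \<Longrightarrow> norm (e \<gamma>) = 1"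
    and "pairwise (\<lambda>\<alpha> \<beta>. orthogonal (e \<alpha>) (e \<beta>)) S"
  shows "coord_proj e S x = (\<Sum>\<gamma>\<in>S. (x \<bullet> e \<gamma>) *\<^sub>R e \<gamma>)"
proof -
  define y where "y = (\<Sum>\<gamma>\<in>S. (x \<bullet> e \<gamma>) *\<^sub>R e \<gamma>)"
  let ?M = "closure (span (e ` S))"
  have sub: "subspace ?M"
    by (simp add: subspace_closure)
  have yM: "y \<in> ?M"
    unfolding y_def
    by (intro subsetD[OF closure_subset] span_sum span_scale span_base imageI)
  have orth: "orthogonal (x - y) z" if "z \<in> ?M" for z
  proof (rule orthogonal_to_closure_span[OF _ that])
    fix v assume "v \<in> e ` S"
    then obtain \<beta> where \<beta>: "\<beta> \<in> S" "v = e \<beta>" by blast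
    have "y \<bullet> e \<beta> = x \<bullet> e \<beta>"
      unfolding y_def by (rule inner_orthonormal_sum[OF assms \<beta>(1)])
    then show "orthogonal (x - y) v"
      using \<beta>(2) by (simp add: orthogonal_def inner_diff_left)
  qed
  have unique: "y' = y" if "y' \<in> ?M" "\<forall>z\<in>?M. orthogonal (x - y') z" for y'
  proof -
    have "y' - y \<in> ?M"
      using sub that(1) yM by (rule subspace_diff)
    then have "(x - y) \<bullet> (y' - y) = 0" "(x - y') \<bullet> (y' - y) = 0"
      using orth that(2) by (auto simp: orthogonal_def)
    then have "(y' - y) \<bullet> (y' - y) = 0"
      by (simp add: inner_diff_left)
    then show ?thesis by simp
  qed
  have "(THE y. y \<in> ?M \<and> (\<forall>z\<in>?M. orthogonal (x - y) z)) = y"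
  proof (rule the_equality)
    show "y \<in> ?M \<and> (\<forall>z\<in>?M. orthogonal (x - y) z)"
      using yM orth by blast
    show "y' = y" if "y' \<in> ?M \<and> (\<forall>z\<in>?M. orthogonal (x - y') z)" for y'
      using unique[of y'] that by (elim conjE)
  qed
  then show ?thesis
    by (simp only: coord_proj_def orth_proj_def y_def)
qed

section \<open>Systems built from almost longest vectors\<close>

text \<open>In a greedily built system the witness \<open>u\<close> is the earliest element of \<open>S\<close>. No order of choice is
  recorded, so that systems can be compared by inclusion. The condition that \<open>a\<close> lies in the closed
  span of the whole system is what lets the system grow: any vector orthogonal to the system is then
  orthogonal to \<open>a\<close>, so that \<open>u\<close> and \<open>a\<close> still serve for \<open>S\<close> enlarged by that vector.\<close>

definition greedy_system :: "real \<Rightarrow> 'a::real_inner set \<Rightarrow> 'a set \<Rightarrow> bool" where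
  "greedy_system \<epsilon> C E \<longleftrightarrow>
     (\<forall>u\<in>E. norm u = 1) \<and> pairwise orthogonal E \<and>
     (\<forall>S. finite S \<and> S \<noteq> {} \<and> S \<subseteq> E \<longrightarrow>
       (\<exists>u\<in>S. \<exists>a\<in>C \<inter> closure (span E). a \<bullet> u > 0 \<and> (\<forall>v\<in>S - {u}. a \<bullet> v = 0) \<and>
          (\<forall>c\<in>C. \<bar>c \<bullet> u\<bar> \<le> (1 + \<epsilon>) * (a \<bullet> u))))"

text \<open>A finite subset of the union of a chain already lies in one member of it, and the closed span
  grows with the system.\<close>

lemma greedy_system_Union:
  assumes chain: "subset.chain (Collect (greedy_system \<epsilon> C)) \<C>" and "\<C> \<noteq> {}"
  shows "greedy_system \<epsilon> C (\<Union>\<C>)"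
proof -
  have greedy: "greedy_system \<epsilon> C E" if "E \<in> \<C>" for E
    using chain that by (auto simp: subset_chain_def)
  have absorb: "\<exists>E\<in>\<C>. S \<subseteq> E" if "finite S" "S \<subseteq> \<Union>\<C>" for S
    by (rule finite_subset_Union_chain[OF that \<open>\<C> \<noteq> {}\<close> chain]) blast
  have "pairwise orthogonal (\<Union>\<C>)"
    unfolding pairwise_def
  proof (intro ballI impI)
    fix u v assume "u \<in> \<Union>\<C>" "v \<in> \<Union>\<C>" "u \<noteq> v"
    then show "orthogonal u v"
      using absorb[of "{u, v}"] greedy by (auto simp: greedy_system_def pairwise_def)
  qed
  moreover have "\<exists>u\<in>S. \<exists>a\<in>C \<inter> closure (span (\<Union>\<C>)). a \<bullet> u > 0 \<and> (\<forall>v\<in>S - {u}. a \<bullet> v = 0) \<and>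
      (\<forall>c\<in>C. \<bar>c \<bullet> u\<bar> \<le> (1 + \<epsilon>) * (a \<bullet> u))" if S: "finite S" "S \<noteq> {}" "S \<subseteq> \<Union>\<C>" for S
  proof -
    obtain E where E: "E \<in> \<C>" "S \<subseteq> E"
      using absorb S by blast
    have "closure (span E) \<subseteq> closure (span (\<Union>\<C>))"
      using E(1) by (intro closure_mono span_mono) blast
    then have "C \<inter> closure (span E) \<subseteq> C \<inter> closure (span (\<Union>\<C>))" by blast
    moreover have "\<exists>u\<in>S. \<exists>a\<in>C \<inter> closure (span E). a \<bullet> u > 0 \<and> (\<forall>v\<in>S - {u}. a \<bullet> v = 0) \<and>
        (\<forall>c\<in>C. \<bar>c \<bullet> u\<bar> \<le> (1 + \<epsilon>) * (a \<bullet> u))"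
      using greedy[OF E(1)] S(1,2) E(2) by (simp add: greedy_system_def)
    ultimately show ?thesis
      by (meson subsetD)
  qed
  moreover have "\<forall>u\<in>\<Union>\<C>. norm u = 1"
    using greedy by (auto simp: greedy_system_def)
  ultimately show ?thesis
    unfolding greedy_system_def by (intro conjI allI impI) simp_all
qed

lemma subspace_with_interior_UNIV:
  fixes M :: "'a::real_normed_vector set"
  assumes "subspace M" and "interior M \<noteq> {}"
  shows "M = UNIV"
proof -
  obtain x r where r: "r > 0" "cball x r \<subseteq> M"
    using assms(2) by (metis ex_in_conv mem_interior_cball)
  have "w \<in> M" for w
  proof (cases "w = 0")
    case False
    let ?t = "r / norm w"
    have "x \<in> cball x r" "x + ?t *\<^sub>R w \<in> cball x r"
      using r(1) False by (simp_all add: dist_norm)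
    then have "x \<in> M" "x + ?t *\<^sub>R w \<in> M"
      using r(2) by blast+
    then have "?t *\<^sub>R w \<in> M"
      using subspace_diff[OF assms(1), of "x + ?t *\<^sub>R w" x] by simp
    then have "(1 / ?t) *\<^sub>R (?t *\<^sub>R w) \<in> M"
      by (rule subspace_scale[OF assms(1)])
    moreover have "(1 / ?t) *\<^sub>R (?t *\<^sub>R w) = w"
      using r(1) False by simp
    ultimately show ?thesis by (simp only:)
  qed (simp add: subspace_0 assms(1))
  then show ?thesis by blast
qed

text \<open>One greedy step. Since the interior of \<open>C\<close> is nonempty, \<open>C\<close> does not lie in the closed span
  \<open>K\<close> of an incomplete system, so the supremum \<open>m\<close> of the distances from points of \<open>C\<close> to \<open>K\<close> is
  positive and can be approximated up to the factor \<open>1 + \<epsilon>\<close>, even where it is not attained. The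
  functional \<open>\<lambda>c. c \<bullet> u\<close> vanishes on \<open>K\<close>, so it is bounded on \<open>C\<close> by \<open>m\<close>.\<close>

lemma greedy_system_extend:
  fixes C :: "'a::{real_inner, banach} set"
  assumes "bounded C" and "interior C \<noteq> {}" and "\<epsilon> > 0"
    and E: "greedy_system \<epsilon> C E" and incomplete: "closure (span E) \<noteq> UNIV"
  obtains u where "u \<notin> E" and "greedy_system \<epsilon> C (insert u E)"
proof -
  let ?K = "closure (span E)"
  have K: "subspace ?K" "closed ?K"
    by (simp_all add: subspace_closure)
  obtain p where pK: "\<And>x. p x \<in> ?K" and p: "\<And>x z. z \<in> ?K \<Longrightarrow> orthogonal (x - p x) z"
    using projection_exists[OF K] by metis
  obtain B where B: "\<And>c. c \<in> C \<Longrightarrow> norm c \<le> B"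
    using assms(1) bounded_iff by blast
  have dist_K: "norm (c - p c) \<le> norm c" for c
  proof -
    have "(norm c)\<^sup>2 = (norm (c - p c))\<^sup>2 + (norm (p c))\<^sup>2"
      using p[OF pK, of c c] norm_add_Pythagorean[of "c - p c" "p c"] by simp
    then have "(norm (c - p c))\<^sup>2 \<le> (norm c)\<^sup>2" by simp
    then show ?thesis by (simp add: power2_le_iff_abs_le)
  qed
  define m where "m = (SUP c\<in>C. norm (c - p c))"
  have bdd: "bdd_above ((\<lambda>c. norm (c - p c)) ` C)"
    using B dist_K by (intro bdd_aboveI2[of _ _ B]) (meson order_trans)
  have le_m: "norm (c - p c) \<le> m" if "c \<in> C" for c
    unfolding m_def by (rule cSUP_upper[OF that bdd])
  have "\<not> C \<subseteq> ?K"
    using subspace_with_interior_UNIV[OF K(1)] incomplete assms(2) interior_mono by blast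
  then obtain c0 where c0: "c0 \<in> C" "c0 \<notin> ?K" by blast
  then have "c0 \<noteq> p c0" using pK by metis
  then have "m > 0"
    using le_m[OF c0(1)] by (metis less_le_trans right_minus_eq zero_less_norm_iff)
  then have "m / (1 + \<epsilon>) < m"
    using \<open>\<epsilon> > 0\<close> by (simp add: field_simps)
  then obtain a where a: "a \<in> C" "m / (1 + \<epsilon>) < norm (a - p a)"
    using less_cSUP_iff[OF _ bdd] c0(1) unfolding m_def by blast
  define t where "t = norm (a - p a)"
  have "0 < m / (1 + \<epsilon>)" using \<open>m > 0\<close> \<open>\<epsilon> > 0\<close> by simp
  with a(2) have t: "t > 0" "m < (1 + \<epsilon>) * t"
    using \<open>\<epsilon> > 0\<close> by (auto simp: t_def field_simps)
  define u where "u = (1 / t) *\<^sub>R (a - p a)"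
  have norm_u: "norm u = 1"
    using t by (simp add: u_def t_def)
  have u_orth: "z \<bullet> u = 0" "u \<bullet> z = 0" if "z \<in> ?K" for z
    using p[OF that, of a] by (simp_all add: u_def orthogonal_def inner_commute)
  have E_K: "E \<subseteq> ?K"
    using closure_subset span_superset by blast
  have a_eq: "a = p a + t *\<^sub>R u"
    using t by (simp add: u_def)
  have au: "a \<bullet> u = t"
    using norm_u u_orth(1)[OF pK, of a] by (subst a_eq) (simp add: inner_add_left norm_eq_1)
  have K_sub: "?K \<subseteq> closure (span (insert u E))"
    by (intro closure_mono span_mono) blast
  have a_in: "a \<in> closure (span (insert u E))"
  proof -
    have "u \<in> closure (span (insert u E))"
      using closure_subset span_base by (metis insertI1 subsetD)
    then show ?thesis
      using a_eq pK[of a] K_sub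
      by (metis subspace_closure subsetD subspace_add subspace_scale subspace_span)
  qed
  have widest: "\<bar>c \<bullet> u\<bar> \<le> (1 + \<epsilon>) * (a \<bullet> u)" if "c \<in> C" for c
  proof -
    have "c \<bullet> u = (c - p c) \<bullet> u"
      using u_orth(1)[OF pK] by (simp add: inner_diff_left)
    then have "\<bar>c \<bullet> u\<bar> \<le> norm (c - p c)"
      using Cauchy_Schwarz_ineq2[of "c - p c" u] norm_u by simp
    then show ?thesis
      unfolding au using le_m[OF that] t(2) by linarith
  qed
  have "u \<notin> E"
    using u_orth(1)[of u] E_K norm_u by (auto simp: norm_eq_1)
  moreover have "greedy_system \<epsilon> C (insert u E)"
    unfolding greedy_system_def
  proof (intro conjI allI impI)
    show "\<forall>v\<in>insert u E. norm v = 1"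
      using E norm_u by (auto simp: greedy_system_def)
    show "pairwise orthogonal (insert u E)"
      using E E_K u_orth by (auto simp: greedy_system_def pairwise_insert orthogonal_def)
    fix S assume S: "finite S \<and> S \<noteq> {} \<and> S \<subseteq> insert u E"
    show "\<exists>v\<in>S. \<exists>a\<in>C \<inter> closure (span (insert u E)). a \<bullet> v > 0 \<and> (\<forall>w\<in>S - {v}. a \<bullet> w = 0) \<and>
      (\<forall>c\<in>C. \<bar>c \<bullet> v\<bar> \<le> (1 + \<epsilon>) * (a \<bullet> v))"
    proof (cases "S = {u}")
      \<comment> \<open>The new vector is the latest one, so it is the earliest element of \<open>S\<close> only here.\<close>
      case True
      then show ?thesis
        using a(1) a_in au t(1) widest by auto
    next
      case False
      then have "S - {u} \<noteq> {}" "S - {u} \<subseteq> E" "finite (S - {u})"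
        using S by auto
      then obtain v b where v: "v \<in> S - {u}" and b: "b \<in> C" "b \<in> ?K" "b \<bullet> v > 0"
        "\<And>w. w \<in> S - {u} - {v} \<Longrightarrow> b \<bullet> w = 0" "\<And>c. c \<in> C \<Longrightarrow> \<bar>c \<bullet> v\<bar> \<le> (1 + \<epsilon>) * (b \<bullet> v)"
        using E unfolding greedy_system_def by (metis IntE)
      have "b \<bullet> w = 0" if "w \<in> S - {v}" for w
        using b(4) u_orth(1)[OF b(2)] that by (cases "w = u") auto
      then show ?thesis
        using v b K_sub by blast
    qed
  qed
  ultimately show thesis by (rule that)
qed

lemma complete_greedy_system_exists:
  fixes C :: "'a::{real_inner, banach} set"
  assumes "bounded C" and "interior C \<noteq> {}" and "\<epsilon> > 0"
  obtains E where "greedy_system \<epsilon> C E" and "closure (span E) = UNIV"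
proof -
  have "\<exists>E\<in>Collect (greedy_system \<epsilon> C). \<forall>X\<in>Collect (greedy_system \<epsilon> C). E \<subseteq> X \<longrightarrow> X = E"
  proof (rule subset_Zorn_nonempty)
    have "greedy_system \<epsilon> C {}"
      by (simp add: greedy_system_def)
    then show "Collect (greedy_system \<epsilon> C) \<noteq> {}" by blast
  qed (simp add: greedy_system_Union)
  then obtain E where E: "greedy_system \<epsilon> C E"
    and max: "\<And>X. greedy_system \<epsilon> C X \<Longrightarrow> E \<subseteq> X \<Longrightarrow> X = E"
    by blast
  have "closure (span E) = UNIV"
    using greedy_system_extend[OF assms E] max by (metis insertI1 subset_insertI)
  with E show thesis by (rule that)
qed

section \<open>Comparison of consecutive hulls\<close>

text \<open>A symmetric convex set absorbs signs into its points and the missing weight into \<open>0\<close>.\<close>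

lemma symmetric_convex_combination:
  fixes C :: "'a::real_inner set"
  assumes "convex C" and "symmetric_set C" and "a \<in> C" "b \<in> C" and "\<bar>s\<bar> + \<bar>t\<bar> \<le> 1"
  shows "s *\<^sub>R a + t *\<^sub>R b \<in> C"
proof -
  have neg: "- c \<in> C" if "c \<in> C" for c
    using assms(2) that unfolding symmetric_set_def by blast
  have "0 \<in> C"
    using convexD[OF assms(1,3) neg[OF assms(3)], of "1/2" "1/2"] by simp
  define a' where "a' = (if s \<ge> 0 then a else - a)"
  define b' where "b' = (if t \<ge> 0 then b else - b)"
  have ab: "a' \<in> C" "b' \<in> C"
    using assms(3,4) neg by (auto simp: a'_def b'_def)
  have eq: "s *\<^sub>R a + t *\<^sub>R b = \<bar>s\<bar> *\<^sub>R a' + \<bar>t\<bar> *\<^sub>R b'"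
    by (auto simp: a'_def b'_def)
  show ?thesis
  proof (cases "\<bar>s\<bar> + \<bar>t\<bar> = 0")
    case True
    then show ?thesis using \<open>0 \<in> C\<close> by (simp add: add_nonneg_eq_0_iff)
  next
    case False
    let ?r = "\<bar>s\<bar> + \<bar>t\<bar>"
    have "(\<bar>s\<bar> / ?r) *\<^sub>R a' + (\<bar>t\<bar> / ?r) *\<^sub>R b' \<in> C"
      using False ab assms(1) by (intro convexD) (auto simp: add_divide_distrib[symmetric])
    from convexD[OF assms(1) this \<open>0 \<in> C\<close>, of ?r "1 - ?r"]
    have "?r *\<^sub>R ((\<bar>s\<bar> / ?r) *\<^sub>R a' + (\<bar>t\<bar> / ?r) *\<^sub>R b') + (1 - ?r) *\<^sub>R 0 \<in> C"
      using assms(5) by simp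
    then show ?thesis
      using False by (simp add: eq scaleR_add_right)
  qed
qed

text \<open>Equality of projections is equality of coordinates; from here on the hulls are treated through
  coordinates only.\<close>

lemma mem_k_convex_hull_iff:
  assumes "\<forall>\<gamma>\<in>\<Gamma>. norm (e \<gamma>) = 1" and "pairwise (\<lambda>\<alpha> \<beta>. orthogonal (e \<alpha>) (e \<beta>)) \<Gamma>"
  shows "x \<in> k_convex_hull \<Gamma> e k C \<longleftrightarrow>
    (\<forall>S\<in>nsets \<Gamma> k. \<exists>c\<in>C. \<forall>\<gamma>\<in>S. c \<bullet> e \<gamma> = x \<bullet> e \<gamma>)"
proof -
  have "coord_proj e S x = coord_proj e S c \<longleftrightarrow> (\<forall>\<gamma>\<in>S. c \<bullet> e \<gamma> = x \<bullet> e \<gamma>)"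
    if "S \<in> nsets \<Gamma> k" for S c
  proof -
    have S: "finite S" "S \<subseteq> \<Gamma>"
      using that by (auto simp: nsets_def)
    have pw: "pairwise (\<lambda>\<alpha> \<beta>. orthogonal (e \<alpha>) (e \<beta>)) S"
      using assms(2) S(2) by (rule pairwise_subset)
    have proj: "coord_proj e S y = (\<Sum>\<gamma>\<in>S. (y \<bullet> e \<gamma>) *\<^sub>R e \<gamma>)" for y
      using assms(1) S by (intro coord_proj_finite[OF S(1) _ pw]) auto
    have coeff: "coord_proj e S y \<bullet> e \<beta> = y \<bullet> e \<beta>" if "\<beta> \<in> S" for y \<beta>
      unfolding proj using assms(1) S by (intro inner_orthonormal_sum[OF S(1) _ pw that]) auto
    show ?thesis
    proof
      show "\<forall>\<gamma>\<in>S. c \<bullet> e \<gamma> = x \<bullet> e \<gamma>" if "coord_proj e S x = coord_proj e S c"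
        using that coeff by metis
      show "coord_proj e S x = coord_proj e S c" if "\<forall>\<gamma>\<in>S. c \<bullet> e \<gamma> = x \<bullet> e \<gamma>"
        using that by (simp add: proj)
    qed
  qed
  then show ?thesis
    unfolding k_convex_hull_def by (auto simp: image_iff)
qed

text \<open>Membership of \<open>x\<close> in the \<open>k\<close>-convex hull is used twice for each set \<open>S\<close> of \<open>Suc k\<close> vectors: on
  \<open>S - {u}\<close> it gives the point \<open>c\<close> to be corrected, and on a \<open>k\<close>-element subset of \<open>S\<close> containing \<open>u\<close>,
  which exists because \<open>k \<ge> 1\<close>, it bounds the coordinate of \<open>x\<close> at \<open>u\<close>. The constant is \<open>1\<close> for \<open>c\<close>
  and \<open>2 * (1 + \<epsilon>)\<close> for the correction.\<close>

lemma k_convex_hull_greedy_system: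
  fixes C :: "'a::{real_inner, banach} set"
  assumes C: "convex C" "symmetric_set C" and "\<epsilon> > 0" and E: "greedy_system \<epsilon> C E"
    and "k \<ge> 1" and x: "x \<in> k_convex_hull E (\<lambda>u. u) k C"
  shows "(1 / (3 + 2 * \<epsilon>)) *\<^sub>R x \<in> k_convex_hull E (\<lambda>u. u) (Suc k) C"
proof -
  have on: "\<forall>u\<in>E. norm u = 1" "pairwise (\<lambda>u v. orthogonal u v) E"
    using E by (auto simp: greedy_system_def)
  note hull_iff = mem_k_convex_hull_iff[of E "\<lambda>u. u", OF on]
  have x: "\<exists>c\<in>C. \<forall>u\<in>S. c \<bullet> u = x \<bullet> u" if "S \<subseteq> E" "finite S" "card S = k" for S
    using x that by (auto simp: hull_iff nsets_def)
  show ?thesis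
    unfolding hull_iff
  proof
    fix S assume "S \<in> nsets E (Suc k)"
    then have S: "S \<subseteq> E" "finite S" "card S = Suc k" by (auto simp: nsets_def)
    then have "S \<noteq> {}" by auto
    then obtain u a where u: "u \<in> S" and a: "a \<in> C" "a \<bullet> u > 0"
      "\<And>v. v \<in> S - {u} \<Longrightarrow> a \<bullet> v = 0" and widest: "\<And>c. c \<in> C \<Longrightarrow> \<bar>c \<bullet> u\<bar> \<le> (1 + \<epsilon>) * (a \<bullet> u)"
      using E S(1,2) unfolding greedy_system_def by (metis IntE)
    obtain c where c: "c \<in> C" "\<And>v. v \<in> S - {u} \<Longrightarrow> c \<bullet> v = x \<bullet> v"
      using x[of "S - {u}"] S u by auto
    \<comment> \<open>Exchanging \<open>u\<close> for another element \<open>w\<close> gives a \<open>k\<close>-element set that contains \<open>u\<close>.\<close>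
    have "card (S - {u}) \<noteq> 0" using S u \<open>k \<ge> 1\<close> by simp
    then have "S - {u} \<noteq> {}" by (metis card.empty)
    then obtain w where w: "w \<in> S - {u}" by blast
    have "\<exists>c'\<in>C. \<forall>v\<in>S - {w}. c' \<bullet> v = x \<bullet> v"
      using S w by (intro x) auto
    moreover have "u \<in> S - {w}" using u w by blast
    ultimately obtain c' where c': "c' \<in> C" "c' \<bullet> u = x \<bullet> u"
      by blast
    \<comment> \<open>Adding this multiple of \<open>a\<close> to \<open>c\<close> corrects the coordinate at \<open>u\<close> and no other one in \<open>S\<close>.\<close>
    define s where "s = (x - c) \<bullet> u / (a \<bullet> u)"
    define r where "r = 3 + 2 * \<epsilon>"
    have r: "r > 0" using \<open>\<epsilon> > 0\<close> by (simp add: r_def)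
    have "\<bar>(x - c) \<bullet> u\<bar> \<le> 2 * ((1 + \<epsilon>) * (a \<bullet> u))"
      using widest[OF c(1)] widest[OF c'(1)] unfolding c'(2) inner_diff_left by linarith
    also have "\<dots> = (r - 1) * (a \<bullet> u)"
      by (simp add: r_def algebra_simps)
    finally have "\<bar>s\<bar> \<le> r - 1"
      using a(2) by (simp add: s_def pos_divide_le_eq)
    moreover have "\<bar>1 / r\<bar> + \<bar>s / r\<bar> = (1 + \<bar>s\<bar>) / r"
      using r by (simp add: add_divide_distrib)
    ultimately have "\<bar>1 / r\<bar> + \<bar>s / r\<bar> \<le> 1"
      using r by simp
    then have "(1 / r) *\<^sub>R c + (s / r) *\<^sub>R a \<in> C"
      by (rule symmetric_convex_combination[OF C c(1) a(1)])
    moreover have "((1 / r) *\<^sub>R c + (s / r) *\<^sub>R a) \<bullet> v = ((1 / r) *\<^sub>R x) \<bullet> v" if "v \<in> S" for v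
    proof -
      have "c \<bullet> v + s * (a \<bullet> v) = x \<bullet> v"
      proof (cases "v = u")
        case True
        have "s * (a \<bullet> u) = (x - c) \<bullet> u"
          using a(2) by (simp add: s_def)
        then show ?thesis
          using True by (simp add: inner_diff_left)
      next
        case False
        then show ?thesis using that a(3) c(2) by simp
      qed
      moreover have "((1 / r) *\<^sub>R c + (s / r) *\<^sub>R a) \<bullet> v = (c \<bullet> v + s * (a \<bullet> v)) / r"
        by (simp add: inner_add_left add_divide_distrib)
      ultimately show ?thesis by simp
    qed
    ultimately show "\<exists>c\<in>C. \<forall>v\<in>S. c \<bullet> v = (1 / (3 + 2 * \<epsilon>)) *\<^sub>R x \<bullet> v"
      unfolding r_def by blast
  qed
qed

theorem theorem1p5:
  fixes C :: "'a::{real_inner, banach} set" and \<delta> :: real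
  assumes "convex_body C" and "symmetric_set C" and "\<delta> > 0"
  shows "\<exists>(\<Gamma> :: 'a set) (e :: 'a \<Rightarrow> 'a).
           complete_orthonormal_system \<Gamma> e \<and>
           (\<forall>k::nat. k \<ge> 2 \<longrightarrow>
              k_convex_hull \<Gamma> e (k - 1) C \<subseteq> (\<lambda>x. (3 + \<delta>) *\<^sub>R x) ` k_convex_hull \<Gamma> e k C)"
proof -
  have C: "convex C" "bounded C" "interior C \<noteq> {}" and "\<delta> / 2 > 0"
    using assms by (auto simp: convex_body_def)
  then obtain E where E: "greedy_system (\<delta> / 2) C E" and complete: "closure (span E) = UNIV"
    using complete_greedy_system_exists by metis
  have "complete_orthonormal_system E (\<lambda>u. u)"
    using E complete by (simp add: complete_orthonormal_system_def greedy_system_def)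
  moreover have "x \<in> (\<lambda>x. (3 + \<delta>) *\<^sub>R x) ` k_convex_hull E (\<lambda>u. u) k C"
    if "k \<ge> 2" and x: "x \<in> k_convex_hull E (\<lambda>u. u) (k - 1) C" for k x
  proof (rule image_eqI)
    show "x = (3 + \<delta>) *\<^sub>R ((1 / (3 + \<delta>)) *\<^sub>R x)"
      using \<open>\<delta> > 0\<close> by simp
    show "(1 / (3 + \<delta>)) *\<^sub>R x \<in> k_convex_hull E (\<lambda>u. u) k C"
      using k_convex_hull_greedy_system[OF C(1) assms(2) \<open>\<delta> / 2 > 0\<close> E _ x] \<open>k \<ge> 2\<close> by simp
  qed
  ultimately show ?thesis by blast
qed

end
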